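(* Let $\mathbb{F}_q$ be any finite field, and let $M$ be any free matroid, of rank $r(M)$. If $m:\mathbb{N}\to\mathbb{N}$ satisfies $m(n)\geq r(M)$ for all sufficiently large $n$, then $$\lim_{n\to\infty}\mathbb{P}_{A_n\sim[U_q]^{m(n)\times n}}\{M \text{ is a minor of } M[A_n]\}=1.$$
   Context: $\mathbb{F}_q$ is the finite field with $q$ elements. $[U_q]^{m\times n}$ denotes the uniform distribution on $\mathbb{F}_q^{m\times n}$ (entries i.i.d. uniform on $\mathbb{F}_q$), and $A \sim [U_q]^{m \times n}$ means that $A$ is drawn from it. For a matrix $A$ over $\mathbb{F}_q$ with $n$ columns, $M[A]$ is the column dependence matroid of $A$: its ground set is the set of column indices $\{1,\dots,n\}$, and a set of indices is independent iff the corresponding columns form a linearly independent family. All matroids are finite. A free matroid is a matroid in which every subset of the ground set is independent. "$M$ is a minor of $N$" means that $M$ is isomorphic to a matroid obtained from $N$ by a sequence of deletions and contractions. *)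

theory Defs
  imports
    "HOL-Probability.Probability_Mass_Function"
    "Jordan_Normal_Form.VS_Connect"
begin

record 'e matroid =
  ground :: "'e set"
  indep :: "'e set \<Rightarrow> bool"

definition is_matroid :: "'e matroid \<Rightarrow> bool" where
  "is_matroid M \<longleftrightarrow>
     finite (ground M) \<and>
     (\<forall>X. indep M X \<longrightarrow> X \<subseteq> ground M) \<and>
     indep M {} \<and>
     (\<forall>X Y. indep M Y \<and> X \<subseteq> Y \<longrightarrow> indep M X) \<and>
     (\<forall>X Y. indep M X \<and> indep M Y \<and> card X < card Y \<longrightarrow>
        (\<exists>y \<in> Y - X. indep M (insert y X)))"

definition matroid_rank :: "'e matroid \<Rightarrow> nat" where
  "matroid_rank M = Max (card ` {X. indep M X})"

definition free_matroid :: "'e matroid \<Rightarrow> bool" where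
  "free_matroid M \<longleftrightarrow> (\<forall>X \<subseteq> ground M. indep M X)"

definition matroid_iso :: "'e matroid \<Rightarrow> 'f matroid \<Rightarrow> bool" where
  "matroid_iso M N \<longleftrightarrow>
     (\<exists>f. bij_betw f (ground M) (ground N) \<and>
          (\<forall>X \<subseteq> ground M. indep M X \<longleftrightarrow> indep N (f ` X)))"

definition basis_in :: "'e matroid \<Rightarrow> 'e set \<Rightarrow> 'e set \<Rightarrow> bool" where
  "basis_in M T B \<longleftrightarrow>
     B \<subseteq> T \<and> indep M B \<and> (\<forall>x \<in> T - B. \<not> indep M (insert x B))"

definition delete :: "'e matroid \<Rightarrow> 'e set \<Rightarrow> 'e matroid" where
  "delete M T = \<lparr>ground = ground M - T, indep = (\<lambda>X. X \<subseteq> ground M - T \<and> indep M X)\<rparr>"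

text \<open>In a matroid, the choice of the basis \<open>B\<close> of \<open>T\<close> does not matter.\<close>

definition contract :: "'e matroid \<Rightarrow> 'e set \<Rightarrow> 'e matroid" where
  "contract M T =
     \<lparr>ground = ground M - T,
      indep = (\<lambda>X. X \<subseteq> ground M - T \<and> (\<exists>B. basis_in M T B \<and> indep M (X \<union> B)))\<rparr>"

inductive reduces_to :: "'e matroid \<Rightarrow> 'e matroid \<Rightarrow> bool" for N where
  refl: "reduces_to N N"
| delete: "reduces_to N N' \<Longrightarrow> T \<subseteq> ground N' \<Longrightarrow> reduces_to N (delete N' T)"
| contract: "reduces_to N N' \<Longrightarrow> T \<subseteq> ground N' \<Longrightarrow> reduces_to N (contract N' T)"

definition is_minor :: "'e matroid \<Rightarrow> 'f matroid \<Rightarrow> bool" where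
  "is_minor M N \<longleftrightarrow> (\<exists>N'. reduces_to N N' \<and> matroid_iso M N')"

text \<open>
  Columns are numbered from \<open>0\<close>. Linear independence is that of the indexed family
  of columns, so an independent set of indices cannot contain two equal columns; this is what
  injectivity expresses, since \<open>lin_dep\<close> only sees the set of columns.
\<close>

definition column_matroid :: "'a::field mat \<Rightarrow> nat matroid" where
  "column_matroid A =
     \<lparr>ground = {..<dim_col A},
      indep = (\<lambda>S. S \<subseteq> {..<dim_col A} \<and> inj_on (col A) S \<and>
        \<not> module.lin_dep class_ring (module_vec TYPE('a) (dim_row A)) (col A ` S))\<rparr>"

text \<open>The set below is finite and nonempty, so this is a genuine uniform distribution.\<close>

definition uniform_mat :: "nat \<Rightarrow> nat \<Rightarrow> 'a::{finite,field} mat pmf" where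
  "uniform_mat m n = pmf_of_set (carrier_mat m n)"

lemma finite_carrier_mat: "finite (carrier_mat m n :: 'a::finite mat set)"
proof (rule finite_subset)
  let ?F = "({..<m} \<times> {..<n}) \<rightarrow>\<^sub>E (UNIV :: 'a set)"
  show "finite (mat m n ` ?F)"
    by (rule finite_imageI, rule finite_PiE) simp_all
  show "carrier_mat m n \<subseteq> mat m n ` ?F"
  proof
    fix A :: "'a mat" assume A: "A \<in> carrier_mat m n"
    have "A = mat m n (restrict (($$) A) ({..<m} \<times> {..<n}))"
      by (rule eq_matI) (use A in simp_all)
    moreover have "restrict (($$) A) ({..<m} \<times> {..<n}) \<in> ?F"
      by (simp add: restrict_def PiE_def extensional_def)
    ultimately show "A \<in> mat m n ` ?F" by (rule image_eqI)
  qed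
qed

lemma carrier_mat_nonempty: "(carrier_mat m n :: 'a::zero mat set) \<noteq> {}"
  using zero_carrier_mat[of m n] by (metis empty_iff)

end

theory Submission
  imports Defs
begin

text \<open>
  For a free matroid of rank \<open>r\<close> it suffices to find \<open>r\<close> independent columns and to delete the
  others. Cut all columns to their first \<open>r\<close> entries. A uniform column is then equal to a given
  unit vector with the probability \<open>q\<^sup>-\<^sup>r\<close>, which does not depend on \<open>m n\<close>, so by a union bound some
  unit vector is missed by all \<open>n\<close> columns with probability at most \<open>r * (1 - q\<^sup>-\<^sup>r)\<^sup>n\<close>.
\<close>

section \<open>Minors from independent columns\<close>

lemma matroid_rank_free:
  assumes "is_matroid M" "free_matroid M"
  shows "matroid_rank M = card (ground M)"
proof -
  have fin: "finite (ground M)" and sub: "\<And>X. indep M X \<Longrightarrow> X \<subseteq> ground M"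
    using assms(1) by (simp_all add: is_matroid_def)
  have eq: "{X. indep M X} = Pow (ground M)"
    using sub assms(2) by (auto simp: free_matroid_def)
  show ?thesis unfolding matroid_rank_def eq
    by (rule Max_eqI) (use fin in \<open>auto intro: card_mono\<close>)
qed

lemma indep_column_matroid_subset:
  assumes "indep (column_matroid A) Y" "X \<subseteq> Y"
  shows "indep (column_matroid (A :: 'a::field mat)) X"
proof -
  interpret vec_space "TYPE('a)" "dim_row A" .
  show ?thesis
    using assms subset_li_is_li[of "col A ` Y" "col A ` X"]
    by (auto simp: column_matroid_def intro: inj_on_subset)
qed

text \<open>Deletion alone suffices: restricted to \<open>J\<close>, the column matroid is free.
  Free matroids on ground sets of equal size are isomorphic through any bijection, so no particular
  \<open>f\<close> has to be built.\<close>

lemma is_minor_free_column_matroid: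
  assumes "is_matroid M" "free_matroid M"
    and J: "indep (column_matroid A) J" "card J = card (ground M)"
  shows "is_minor M (column_matroid A)"
proof -
  let ?N = "column_matroid A"
  let ?N' = "delete ?N (ground ?N - J)"
  have sub: "J \<subseteq> ground ?N" using J(1) by (simp add: column_matroid_def)
  then have "finite J" by (rule finite_subset) (simp add: column_matroid_def)
  moreover have "finite (ground M)" using assms(1) by (simp add: is_matroid_def)
  ultimately obtain f where f: "bij_betw f (ground M) J"
    using finite_same_card_bij J(2) by metis
  have "matroid_iso M ?N'" unfolding matroid_iso_def
  proof (intro exI conjI allI impI)
    show "bij_betw f (ground M) (ground ?N')"
      using f sub by (simp add: delete_def double_diff)
    fix X assume X: "X \<subseteq> ground M"
    then have "f ` X \<subseteq> J" using f by (auto simp: bij_betw_def)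
    then show "indep M X \<longleftrightarrow> indep ?N' (f ` X)"
      using X assms(2) sub indep_column_matroid_subset[OF J(1)]
      by (auto simp: delete_def free_matroid_def)
  qed
  moreover have "reduces_to ?N ?N'"
    by (rule reduces_to.delete[OF reduces_to.refl]) auto
  ultimately show ?thesis unfolding is_minor_def by blast
qed

text \<open>The first \<open>r\<close> rows of the chosen columns form an identity matrix, so
  coordinate \<open>k\<close> of a linear combination is just the coefficient of column
  \<open>j k\<close>. The same rows show that the columns are pairwise distinct, hence
  \<open>j\<close> is injective.\<close>

lemma indep_column_matroid_unit_prefix:
  fixes A :: "'a::field mat"
  assumes "r \<le> dim_row A"
    and j: "\<And>i. i < r \<Longrightarrow> j i < dim_col A"
    and prefix: "\<And>i. i < r \<Longrightarrow> \<exists>u. col A (j i) = unit_vec r i @\<^sub>v u"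
  shows "indep (column_matroid A) (j ` {..<r})" and "card (j ` {..<r}) = r"
proof -
  interpret vec_space "TYPE('a)" "dim_row A" .
  have entry: "col A (j i) $ k = (if k = i then 1 else 0)" if "i < r" "k < r" for i k
    using prefix[OF that(1)] that by auto
  have inj: "inj_on (\<lambda>i. col A (j i)) {..<r}"
    by (rule inj_onI) (metis entry lessThan_iff zero_neq_one)
  then have "inj_on j {..<r}" by (auto simp: inj_on_def)
  then show "card (j ` {..<r}) = r" by (simp add: card_image)
  have "lin_indpt ((\<lambda>i. col A (j i)) ` {..<r})"
  proof (rule finite_lin_indpt2)
    fix a assume zero: "lincomb a ((\<lambda>i. col A (j i)) ` {..<r}) = 0\<^sub>v (dim_row A)"
    have "a (col A (j k)) = 0" if k: "k < r" for k
    proof -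
      have "0 = lincomb a ((\<lambda>i. col A (j i)) ` {..<r}) $ k"
        using zero k assms(1) by simp
      also have "\<dots> = (\<Sum>v\<in>(\<lambda>i. col A (j i)) ` {..<r}. a v * v $ k)"
        by (rule lincomb_index) (use k assms(1) in auto)
      \<comment> \<open>\<open>lincomb\<close> sums over the set of columns; distinctness of the
        columns permits summing over their indices instead.\<close>
      also have "\<dots> = (\<Sum>i<r. a (col A (j i)) * col A (j i) $ k)"
        by (simp add: sum.reindex[OF inj])
      also have "\<dots> = (\<Sum>i<r. if i = k then a (col A (j i)) else 0)"
        by (rule sum.cong) (simp_all add: entry k del: index_col)
      also have "\<dots> = a (col A (j k))" using k by simp
      finally show ?thesis by simp
    qed
    then show "\<forall>v\<in>(\<lambda>i. col A (j i)) ` {..<r}. a v = 0"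
      by auto
  qed auto
  then show "indep (column_matroid A) (j ` {..<r})"
    using j inj by (auto simp: column_matroid_def inj_on_def image_image)
qed

section \<open>Counting columns\<close>

text \<open>A matrix is the family of its columns, so a condition imposed on each column separately
  cuts out a product set. Counting this product takes the place of an argument by independence of
  the columns.\<close>

lemma bij_betw_cols:
  assumes "S \<subseteq> carrier_vec m"
  shows "bij_betw (\<lambda>A. \<lambda>j\<in>{..<n}. col A j)
    {A \<in> carrier_mat m n. \<forall>j<n. col A j \<in> S} ({..<n} \<rightarrow>\<^sub>E S)"
proof (rule bij_betw_byWitness[where f' = "\<lambda>f. mat m n (\<lambda>(i, j). f j $ i)"])
  have col: "col (mat m n (\<lambda>(i, j). f j $ i)) k = f k" if "f \<in> {..<n} \<rightarrow>\<^sub>E S" "k < n" for f k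
  proof (rule eq_vecI)
    have "f k \<in> carrier_vec m" using that assms by auto
    then show "dim_vec (col (mat m n (\<lambda>(i, j). f j $ i)) k) = dim_vec (f k)"
      and "\<And>i. i < dim_vec (f k) \<Longrightarrow> col (mat m n (\<lambda>(i, j). f j $ i)) k $ i = f k $ i"
      using that by auto
  qed
  then show "(\<lambda>f. mat m n (\<lambda>(i, j). f j $ i)) ` ({..<n} \<rightarrow>\<^sub>E S)
      \<subseteq> {A \<in> carrier_mat m n. \<forall>j<n. col A j \<in> S}"
    by (auto simp: PiE_iff)
  show "\<forall>f \<in> {..<n} \<rightarrow>\<^sub>E S. (\<lambda>j\<in>{..<n}. col (mat m n (\<lambda>(i, j). f j $ i)) j) = f"
  proof
    fix f assume f: "f \<in> {..<n} \<rightarrow>\<^sub>E S"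
    show "(\<lambda>j\<in>{..<n}. col (mat m n (\<lambda>(i, j). f j $ i)) j) = f"
      by (rule ext) (use f col[OF f] in \<open>auto simp: restrict_def PiE_arb[OF f]\<close>)
  qed
  show "\<forall>A \<in> {A \<in> carrier_mat m n. \<forall>j<n. col A j \<in> S}.
      mat m n (\<lambda>(i, j). (\<lambda>j\<in>{..<n}. col A j) j $ i) = A"
    by auto
qed auto

lemma card_mat_cols_in:
  "S \<subseteq> carrier_vec m \<Longrightarrow> card {A \<in> carrier_mat m n. \<forall>j<n. col A j \<in> S} = card S ^ n"
  by (subst bij_betw_same_card[OF bij_betw_cols]) (simp_all add: card_PiE)

text \<open>Each vector is the single column of an \<open>m\<close> by 1 matrix, and there are
  finitely many of those.\<close>

lemma finite_carrier_vec: "finite (carrier_vec m :: 'a::finite vec set)"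
proof (rule finite_surj[OF finite_carrier_mat[of m 1], of _ "\<lambda>A. col A 0"], rule subsetI)
  fix v :: "'a vec" assume v: "v \<in> carrier_vec m"
  show "v \<in> (\<lambda>A. col A 0) ` carrier_mat m 1"
    by (rule image_eqI[of _ _ "mat m 1 (\<lambda>(i, j). v $ i)"]) (use v in \<open>auto intro: eq_vecI\<close>)
qed

lemma card_carrier_vec_pos: "card (carrier_vec m :: 'a::{finite,zero} vec set) > 0"
  using zero_carrier_vec[of m] finite_carrier_vec card_gt_0_iff by blast

lemma prob_uniform_mat_cols_avoid:
  assumes C: "C \<subseteq> carrier_vec m"
  shows "measure_pmf.prob (uniform_mat m n :: 'a::{finite,field} mat pmf) {A. \<forall>j<n. col A j \<notin> C}
    = (1 - card C / card (carrier_vec m :: 'a vec set)) ^ n"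
proof -
  let ?V = "carrier_vec m :: 'a vec set"
  have "carrier_mat m n \<inter> {A. \<forall>j<n. col A j \<notin> C}
      = {A \<in> carrier_mat m n. \<forall>j<n. col A j \<in> ?V - C}"
    by auto
  \<comment> \<open>Taking all of \<open>?V\<close> as the allowed set lets the same count give the
    denominator.\<close>
  moreover have "(carrier_mat m n :: 'a mat set) = {A \<in> carrier_mat m n. \<forall>j<n. col A j \<in> ?V}"
    by auto
  ultimately have "measure_pmf.prob (uniform_mat m n) {A. \<forall>j<n. col A j \<notin> C}
      = real (card (?V - C) ^ n) / real (card ?V ^ n)"
    using card_mat_cols_in[of "?V - C" m n] card_mat_cols_in[of ?V m n]
    by (simp add: uniform_mat_def measure_pmf_of_set carrier_mat_nonempty finite_carrier_mat)
  also have "card (?V - C) = card ?V - card C"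
    using C finite_subset[OF C finite_carrier_vec] by (rule card_Diff_subset[rotated])
  also have "real ((card ?V - card C) ^ n) / real (card ?V ^ n) = (1 - card C / card ?V) ^ n"
    using card_carrier_vec_pos[where 'a = 'a, of m] card_mono[OF finite_carrier_vec C]
    by (simp add: of_nat_diff diff_divide_distrib flip: power_divide)
  finally show ?thesis .
qed

lemma card_carrier_vec_add:
  "card (carrier_vec (r + k) :: 'a::finite vec set)
    = card (carrier_vec r :: 'a vec set) * card (carrier_vec k :: 'a vec set)"
proof -
  have "bij_betw (\<lambda>(w, u). w @\<^sub>v u) (carrier_vec r \<times> carrier_vec k)
      (carrier_vec (r + k) :: 'a vec set)"
    by (rule bij_betw_byWitness[where f' = "\<lambda>v. (vec_first v r, vec_last v k)"])
      (auto simp: vec_first_def vec_last_def intro!: eq_vecI)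
  from bij_betw_same_card[OF this] show ?thesis by (simp add: card_cartesian_product)
qed

text \<open>The remaining \<open>m - r\<close> entries are free, and their contribution cancels. The
  fraction therefore does not involve \<open>m\<close>, which is why the growth of
  \<open>m n\<close> is irrelevant in the limit.\<close>

lemma card_prefix_fraction:
  fixes w :: "'a::{finite,zero} vec"
  assumes "w \<in> carrier_vec r" "r \<le> m"
  shows "card ((@\<^sub>v) w ` carrier_vec (m - r)) / card (carrier_vec m :: 'a vec set)
    = 1 / card (carrier_vec r :: 'a vec set)"
proof -
  have "card ((@\<^sub>v) w ` carrier_vec (m - r)) = card (carrier_vec (m - r) :: 'a vec set)"
    by (rule card_image) (use assms append_vec_eq in \<open>auto simp: inj_on_def\<close>)
  then show ?thesis
    using card_carrier_vec_add[where 'a = 'a, of r "m - r"] assms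
      card_carrier_vec_pos[where 'a = 'a, of "m - r"]
    by simp
qed

lemma prob_indep_columns_ge:
  assumes "r \<le> m"
  shows "measure_pmf.prob (uniform_mat m n :: 'a::{finite,field} mat pmf)
      {A. \<exists>J. indep (column_matroid A) J \<and> card J = r}
    \<ge> 1 - r * (1 - 1 / card (carrier_vec r :: 'a vec set)) ^ n"
proof -
  let ?p = "uniform_mat m n :: 'a mat pmf"
  let ?G = "{A. \<exists>J. indep (column_matroid (A :: 'a mat)) J \<and> card J = r}"
  define C where "C i = (@\<^sub>v) (unit_vec r i) ` (carrier_vec (m - r) :: 'a vec set)" for i
  define B where "B i = {A. \<forall>j<n. col A j \<notin> C i}" for i
  have C: "C i \<subseteq> carrier_vec m" for i
  proof
    fix v assume "v \<in> C i"
    then obtain u where "v = unit_vec r i @\<^sub>v u" "u \<in> carrier_vec (m - r)"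
      by (auto simp: C_def)
    then show "v \<in> carrier_vec m" using assms by (intro carrier_vecI) simp
  qed
  \<comment> \<open>The covering is claimed only on the support, where \<open>A\<close> has the
    right dimensions; this is enough for the union to have probability 1.\<close>
  have "A \<in> ?G \<union> (\<Union>i<r. B i)" if "A \<in> set_pmf ?p" for A
  proof (rule ccontr)
    assume A: "A \<notin> ?G \<union> (\<Union>i<r. B i)"
    have dim: "A \<in> carrier_mat m n"
      using that by (simp add: uniform_mat_def finite_carrier_mat carrier_mat_nonempty)
    from A have "\<forall>i<r. \<exists>j<n. col A j \<in> C i" by (auto simp: B_def)
    \<comment> \<open>One column is picked for each unit prefix. That different prefixes get
      different columns need not be arranged here, since the prefixes force it.\<close>
    then obtain j where j: "\<And>i. i < r \<Longrightarrow> j i < n \<and> col A (j i) \<in> C i" by metis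
    have "indep (column_matroid A) (j ` {..<r})" "card (j ` {..<r}) = r"
      by (rule indep_column_matroid_unit_prefix; use j dim assms in \<open>force simp: C_def\<close>)+
    then have "A \<in> ?G" by blast
    then show False using A by simp
  qed
  then have "1 = measure_pmf.prob ?p (?G \<union> (\<Union>i<r. B i))"
    by (intro measure_pmf.prob_eq_1[THEN iffD2, symmetric]) (auto simp: AE_measure_pmf_iff)
  also have "\<dots> \<le> measure_pmf.prob ?p ?G + measure_pmf.prob ?p (\<Union>i<r. B i)"
    by (rule measure_Un_le) auto
  also have "measure_pmf.prob ?p (\<Union>i<r. B i) \<le> (\<Sum>i<r. measure_pmf.prob ?p (B i))"
    by (rule measure_UNION_le) auto
  also have "\<dots> = (\<Sum>i<r. (1 - 1 / card (carrier_vec r :: 'a vec set)) ^ n)"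
    unfolding B_def prob_uniform_mat_cols_avoid[OF C]
    by (simp add: C_def card_prefix_fraction[OF _ assms])
  finally show ?thesis by simp
qed

theorem theorem2:
  fixes M :: "'e matroid" and m :: "nat \<Rightarrow> nat"
  assumes "is_matroid M" and "free_matroid M"
    and "\<forall>\<^sub>F n in sequentially. matroid_rank M \<le> m n"
  shows "(\<lambda>n. measure_pmf.prob (uniform_mat (m n) n :: 'a::{finite,field} mat pmf)
            {A. is_minor M (column_matroid A)}) \<longlonglongrightarrow> 1"
proof (rule tendsto_sandwich)
  let ?r = "matroid_rank M"
  let ?Q = "card (carrier_vec ?r :: 'a vec set)"
  show "\<forall>\<^sub>F n in sequentially. 1 - ?r * (1 - 1 / ?Q) ^ n
      \<le> measure_pmf.prob (uniform_mat (m n) n :: 'a mat pmf) {A. is_minor M (column_matroid A)}"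
    using assms(3)
  proof eventually_elim
    case (elim n)
    show ?case
      \<comment> \<open>The rank of a free matroid is the size of its ground set, so
        \<open>?r\<close> independent columns already yield \<open>M\<close> as a minor.\<close>
      by (rule order_trans[OF prob_indep_columns_ge[OF elim]],
          rule measure_pmf.finite_measure_mono)
        (use assms in \<open>auto simp: matroid_rank_free intro: is_minor_free_column_matroid\<close>)
  qed
  have "?Q > 0" by (rule card_carrier_vec_pos)
  \<comment> \<open>\<open>?Q\<close> is fixed as \<open>n\<close> grows, so this is a constant
    ratio below 1. It is 0 if \<open>?r = 0\<close>, where \<open>?Q = 1\<close>.\<close>
  then have "0 \<le> 1 - 1 / real ?Q" "1 - 1 / real ?Q < 1" by auto
  then have "(\<lambda>n. (1 - 1 / ?Q) ^ n) \<longlonglongrightarrow> 0" by (rule LIMSEQ_realpow_zero)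
  then have "(\<lambda>n. 1 - ?r * (1 - 1 / ?Q) ^ n) \<longlonglongrightarrow> 1 - real ?r * 0"
    by (intro tendsto_diff tendsto_mult tendsto_const)
  then show "(\<lambda>n. 1 - ?r * (1 - 1 / ?Q) ^ n) \<longlonglongrightarrow> 1" by simp
qed auto

end
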